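(* There exists a linear Anosov automorphism $f$ of $\mathbb T^3$ whose $C^\infty$-centralizer $\mathcal Z^\infty(f)$ is discrete, is non-trivial (that is, $\mathcal Z^\infty(f)\neq\{f^n:n\in\mathbb Z\}$), and contains an Anosov diffeomorphism $h$ that does not satisfy any of the equations $h^n=f^m$ for $m,n\in\mathbb Z\setminus\{0\}$. In particular, the Anosov diffeomorphism $f$ does not belong to the residual subsets $\mathcal R$, recalled in the context, consisting of diffeomorphisms $g$ for which the $C^1$-centralizer $\mathcal Z^1(g|_{\Lambda_g})$ on the hyperbolic basic set $\Lambda_g$ is trivial (here the hyperbolic basic set is the whole torus $\mathbb T^3$).
   Context: $\mathbb T^3=\mathbb R^3/\mathbb Z^3$. A linear Anosov automorphism of $\mathbb T^3$ is the diffeomorphism induced by a matrix $A\in GL(3,\mathbb Z)$, $|\det A|=1$, with no eigenvalue of modulus $1$. For $k\in\mathbb N\cup\{\infty\}$, $\mathcal Z^k(f)=\{g\in\mathrm{Diff}^k(\mathbb T^3):g\circ f=f\circ g\}$, and it is trivial if it equals $\{f^n:n\in\mathbb Z\}$; discreteness is as a subset of $\mathrm{Diff}^\infty(\mathbb T^3)$. A compact invariant set $\Lambda$ of a diffeomorphism $g$ of a compact manifold $M$ is a hyperbolic basic set if it has a dense orbit and there are a $Dg$-invariant splitting $T_\Lambda M=E^s\oplus E^u$ and constants $C>0$, $\lambda\in(0,1)$ such that $\|Dg^n(x)|_{E^s_x}\|\le C\lambda^n$ and $\|(Dg^n(x)|_{E^u_x})^{-1}\|\le C\lambda^n$ for all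 $x\in\Lambda$, $n\ge1$. A diffeomorphism is Anosov if the whole manifold $M$ satisfies this hyperbolicity condition. The residual subsets referred to are those given by the following result of the same paper. Let $1\le r\le\infty$, $f_0\in\mathrm{Diff}^r(M)$, let $\Lambda_{f_0}\subset M$ be a maximal invariant set for $f_0$, let $\mathcal U\subset\mathrm{Diff}^r(M)$ be an open neighborhood of $f_0$ and $U\subset M$ an open set such that the analytic continuation of hyperbolic basic sets $\mathcal U\ni g\mapsto\Lambda_g:=\bigcap_{n\in\mathbb Z}g^n(U)$ is well defined. Then there exist a $C^r$-open neighborhood $\mathcal U$ of $f_0$ and a residual subset $\mathcal R\subset\mathcal U$ such that $\mathcal Z^1(g|_{\Lambda_g})$ is trivial, i.e. consists only of the powers of $g|_{\Lambda_g}$, for every $g\in\mathcal R$. For the example, $M=U=\Lambda_g=\mathbb T^3$, so that $\mathcal Z^1(g|_{\Lambda_g})=\mathcal Z^1(g)$. *)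

theory Defs
  imports "HOL-Analysis.Analysis" "HOL-Library.Extended_Nat"
begin

subsection \<open>The torus as the quotient of \<open>\<real>\<^sup>3\<close> by the integer lattice\<close>

definition lattice_rel :: "real^3 \<Rightarrow> real^3 \<Rightarrow> bool" where
  "lattice_rel x y \<longleftrightarrow> (\<forall>i. x $ i - y $ i \<in> \<int>)"

lemma equivp_lattice_rel: "equivp lattice_rel"
proof (rule equivpI)
  show "reflp lattice_rel"
    by (simp add: reflp_def lattice_rel_def)
  show "symp lattice_rel"
    unfolding symp_def lattice_rel_def by (metis Ints_minus minus_diff_eq)
  show "transp lattice_rel"
    unfolding transp_def lattice_rel_def
  proof (intro allI impI)
    fix x y z :: "real^3" and i
    assume "\<forall>i. x $ i - y $ i \<in> \<int>" "\<forall>i. y $ i - z $ i \<in> \<int>"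
    then have "(x $ i - y $ i) + (y $ i - z $ i) \<in> \<int>"
      by (intro Ints_add) auto
    then show "x $ i - z $ i \<in> \<int>" by simp
  qed
qed

quotient_type torus3 = "real^3" / lattice_rel
  morphisms rep_torus proj_torus
  by (rule equivp_lattice_rel)

lemma proj_torus_eq_iff: "proj_torus x = proj_torus y \<longleftrightarrow> (\<forall>i. x $ i - y $ i \<in> \<int>)"
  by (simp add: torus3.abs_eq_iff lattice_rel_def)

lemma surj_proj_torus: "surj proj_torus"
  by (metis Quotient3_abs_rep Quotient3_torus3 surjI)

instantiation torus3 :: topological_space
begin

definition open_torus3 :: "torus3 set \<Rightarrow> bool" where
  "open_torus3 U \<longleftrightarrow> open (proj_torus -` U)"

instance
  by standard (auto simp: open_torus3_def vimage_Int vimage_Union)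

end

subsection \<open>Maps of class \<open>C\<^sup>k\<close>\<close>

primrec higher_differentiable_on ::
    "nat \<Rightarrow> 'a::real_normed_vector set \<Rightarrow> ('a \<Rightarrow> 'b::real_normed_vector) \<Rightarrow> bool" where
  "higher_differentiable_on 0 S F \<longleftrightarrow> continuous_on S F"
| "higher_differentiable_on (Suc n) S F \<longleftrightarrow>
     (\<forall>x\<in>S. F differentiable (at x)) \<and>
     (\<forall>v. higher_differentiable_on n S (\<lambda>x. frechet_derivative F (at x) v))"

definition smooth_of_class ::
    "enat \<Rightarrow> 'a::real_normed_vector set \<Rightarrow> ('a \<Rightarrow> 'b::real_normed_vector) \<Rightarrow> bool" where
  "smooth_of_class k S F \<longleftrightarrow> (\<forall>n. enat n \<le> k \<longrightarrow> higher_differentiable_on n S F)"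

text \<open>The projection is a local diffeomorphism and its local inverses are the charts of the torus,
  so the local lifts of a self-map are its expressions in charts.\<close>

definition local_lift :: "(real^3) set \<Rightarrow> (real^3 \<Rightarrow> real^3) \<Rightarrow> (torus3 \<Rightarrow> torus3) \<Rightarrow> bool" where
  "local_lift S F g \<longleftrightarrow> open S \<and> (\<forall>x\<in>S. g (proj_torus x) = proj_torus (F x))"

definition torus_map_of_class :: "enat \<Rightarrow> (torus3 \<Rightarrow> torus3) \<Rightarrow> bool" where
  "torus_map_of_class k g \<longleftrightarrow> (\<forall>x. \<exists>S F. x \<in> S \<and> local_lift S F g \<and> smooth_of_class k S F)"

definition Diff :: "enat \<Rightarrow> (torus3 \<Rightarrow> torus3) set" where
  "Diff k = {g. bij g \<and> torus_map_of_class k g \<and> torus_map_of_class k (inv g)}"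

subsection \<open>The \<open>C\<^sup>r\<close> topology on \<open>Diff r\<close>\<close>

primrec iter_deriv ::
    "'a list \<Rightarrow> ('a::real_normed_vector \<Rightarrow> 'b::real_normed_vector) \<Rightarrow> 'a \<Rightarrow> 'b" where
  "iter_deriv [] F = F"
| "iter_deriv (v # vs) F = (\<lambda>x. frechet_derivative (iter_deriv vs F) (at x) v)"

text \<open>Two maps are close if at every point they have local lifts whose values and partial
  derivatives of order at most \<open>n\<close> are close, uniformly in the point. Since the lifts may be
  changed by integer vectors, order \<open>0\<close> is uniform closeness for the quotient metric.\<close>

definition Cr_nhd ::
    "enat \<Rightarrow> nat \<Rightarrow> real \<Rightarrow> (torus3 \<Rightarrow> torus3) \<Rightarrow> (torus3 \<Rightarrow> torus3) set" where
  "Cr_nhd r n \<epsilon> f = {g \<in> Diff r. \<forall>x. \<exists>S F G. x \<in> S \<and>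
      local_lift S F f \<and> smooth_of_class r S F \<and>
      local_lift S G g \<and> smooth_of_class r S G \<and>
      (\<forall>vs. set vs \<subseteq> Basis \<and> length vs \<le> n \<longrightarrow>
         norm (iter_deriv vs F x - iter_deriv vs G x) < \<epsilon>)}"

text \<open>For \<open>r = \<infinity>\<close> every finite order \<open>n\<close> is allowed.\<close>

definition Diff_open :: "enat \<Rightarrow> (torus3 \<Rightarrow> torus3) set \<Rightarrow> bool" where
  "Diff_open r V \<longleftrightarrow> V \<subseteq> Diff r \<and>
     (\<forall>f\<in>V. \<exists>n \<epsilon>. enat n \<le> r \<and> \<epsilon> > 0 \<and> Cr_nhd r n \<epsilon> f \<subseteq> V)"

definition Diff_topology :: "enat \<Rightarrow> (torus3 \<Rightarrow> torus3) topology" where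
  "Diff_topology r = topology (Diff_open r)"

lemma Cr_nhd_mono:
  assumes "m \<le> n" "\<epsilon> \<le> \<delta>"
  shows "Cr_nhd r n \<epsilon> f \<subseteq> Cr_nhd r m \<delta> f"
proof
  fix g assume g: "g \<in> Cr_nhd r n \<epsilon> f"
  have "\<exists>S F G. x \<in> S \<and>
      local_lift S F f \<and> smooth_of_class r S F \<and>
      local_lift S G g \<and> smooth_of_class r S G \<and>
      (\<forall>vs. set vs \<subseteq> Basis \<and> length vs \<le> m \<longrightarrow>
         norm (iter_deriv vs F x - iter_deriv vs G x) < \<delta>)" for x
  proof -
    obtain S F G where *: "x \<in> S" "local_lift S F f" "smooth_of_class r S F"
      "local_lift S G g" "smooth_of_class r S G"
      and **: "\<forall>vs. set vs \<subseteq> Basis \<and> length vs \<le> n \<longrightarrow>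
         norm (iter_deriv vs F x - iter_deriv vs G x) < \<epsilon>"
      using g unfolding Cr_nhd_def by blast
    have "\<forall>vs. set vs \<subseteq> Basis \<and> length vs \<le> m \<longrightarrow>
         norm (iter_deriv vs F x - iter_deriv vs G x) < \<delta>"
      using ** assms by (meson le_trans less_le_trans)
    with * show ?thesis by blast
  qed
  then show "g \<in> Cr_nhd r m \<delta> f"
    using g unfolding Cr_nhd_def by blast
qed

lemma istopology_Diff_open: "istopology (Diff_open r)"
  unfolding istopology_def
proof (intro conjI allI impI)
  fix V W assume V: "Diff_open r V" and W: "Diff_open r W"
  show "Diff_open r (V \<inter> W)"
    unfolding Diff_open_def
  proof (intro conjI ballI)
    show "V \<inter> W \<subseteq> Diff r" using V by (auto simp: Diff_open_def)
    fix f assume "f \<in> V \<inter> W"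
    then obtain m \<delta> n \<epsilon> where
      m: "enat m \<le> r" "\<delta> > 0" "Cr_nhd r m \<delta> f \<subseteq> V" and
      n: "enat n \<le> r" "\<epsilon> > 0" "Cr_nhd r n \<epsilon> f \<subseteq> W"
      using V W unfolding Diff_open_def by (metis IntE)
    have "Cr_nhd r (max m n) (min \<delta> \<epsilon>) f \<subseteq> V \<inter> W"
      using m(3) n(3) Cr_nhd_mono[of m "max m n" "min \<delta> \<epsilon>" \<delta> r f]
        Cr_nhd_mono[of n "max m n" "min \<delta> \<epsilon>" \<epsilon> r f] by auto
    moreover have "enat (max m n) \<le> r" using m(1) n(1) by (simp add: max_def)
    moreover have "min \<delta> \<epsilon> > 0" using m(2) n(2) by simp
    ultimately show "\<exists>n \<epsilon>. enat n \<le> r \<and> \<epsilon> > 0 \<and> Cr_nhd r n \<epsilon> f \<subseteq> V \<inter> W"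
      by blast
  qed
next
  fix \<V> assume *: "\<forall>V\<in>\<V>. Diff_open r V"
  show "Diff_open r (\<Union>\<V>)"
    unfolding Diff_open_def
  proof (intro conjI ballI)
    show "\<Union>\<V> \<subseteq> Diff r" using * by (auto simp: Diff_open_def)
    fix f assume "f \<in> \<Union>\<V>"
    then obtain V where V: "V \<in> \<V>" "f \<in> V" by blast
    then obtain n \<epsilon> where "enat n \<le> r" "\<epsilon> > 0" "Cr_nhd r n \<epsilon> f \<subseteq> V"
      using * unfolding Diff_open_def by metis
    with V(1) show "\<exists>n \<epsilon>. enat n \<le> r \<and> \<epsilon> > 0 \<and> Cr_nhd r n \<epsilon> f \<subseteq> \<Union>\<V>"
      by (meson Union_upper subset_trans)
  qed
qed

lemma openin_Diff_topology: "openin (Diff_topology r) V \<longleftrightarrow> Diff_open r V"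
  by (simp add: Diff_topology_def istopology_Diff_open)

lemma topspace_Diff_topology: "topspace (Diff_topology r) = Diff r"
proof
  show "topspace (Diff_topology r) \<subseteq> Diff r"
    by (auto simp: topspace_def openin_Diff_topology Diff_open_def)
  have "Diff_open r (Diff r)"
    unfolding Diff_open_def
  proof (intro conjI ballI subset_refl)
    fix f
    have "enat 0 \<le> r" by (simp add: zero_enat_def[symmetric])
    moreover have "Cr_nhd r 0 1 f \<subseteq> Diff r" by (auto simp: Cr_nhd_def)
    ultimately show "\<exists>n \<epsilon>. enat n \<le> r \<and> \<epsilon> > 0 \<and> Cr_nhd r n \<epsilon> f \<subseteq> Diff r"
      using zero_less_one by blast
  qed
  then show "Diff r \<subseteq> topspace (Diff_topology r)"
    by (simp add: openin_subset openin_Diff_topology)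
qed

definition residual_in :: "'a topology \<Rightarrow> 'a set \<Rightarrow> bool" where
  "residual_in X R \<longleftrightarrow> R \<subseteq> topspace X \<and>
     (\<exists>V :: nat \<Rightarrow> 'a set. (\<forall>n. openin X (V n) \<and> X closure_of V n = topspace X) \<and> (\<Inter>n. V n) \<subseteq> R)"

subsection \<open>Centralizers\<close>

definition int_iter :: "('a \<Rightarrow> 'a) \<Rightarrow> int \<Rightarrow> 'a \<Rightarrow> 'a" where
  "int_iter f n = (if n \<ge> 0 then f ^^ nat n else inv f ^^ nat (- n))"

definition centralizer :: "enat \<Rightarrow> (torus3 \<Rightarrow> torus3) \<Rightarrow> (torus3 \<Rightarrow> torus3) set" where
  "centralizer k f = {g \<in> Diff k. g \<circ> f = f \<circ> g}"

definition trivial_centralizer :: "enat \<Rightarrow> (torus3 \<Rightarrow> torus3) \<Rightarrow> bool" where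
  "trivial_centralizer k f \<longleftrightarrow> centralizer k f = range (int_iter f)"

subsection \<open>Hyperbolicity\<close>

text \<open>All tangent spaces are identified with \<open>\<real>\<^sup>3\<close> through the derivative of the projection. Two
  lifts that are continuous at a point differ near it by a constant, so the derivative is unique.\<close>

definition has_torus_derivative ::
    "(torus3 \<Rightarrow> torus3) \<Rightarrow> (real^3 \<Rightarrow> real^3) \<Rightarrow> torus3 \<Rightarrow> bool" where
  "has_torus_derivative g L p \<longleftrightarrow>
     (\<exists>S F x. p = proj_torus x \<and> x \<in> S \<and> local_lift S F g \<and> (F has_derivative L) (at x))"

definition torus_deriv :: "(torus3 \<Rightarrow> torus3) \<Rightarrow> torus3 \<Rightarrow> real^3 \<Rightarrow> real^3" where
  "torus_deriv g p = (THE L. has_torus_derivative g L p)"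

definition restr_norm_le :: "(real^3 \<Rightarrow> real^3) \<Rightarrow> (real^3) set \<Rightarrow> real \<Rightarrow> bool" where
  "restr_norm_le L E c \<longleftrightarrow> (\<forall>v\<in>E. norm (L v) \<le> c * norm v)"

definition hyperbolic_set :: "(torus3 \<Rightarrow> torus3) \<Rightarrow> torus3 set \<Rightarrow> bool" where
  "hyperbolic_set g \<Lambda> \<longleftrightarrow> compact \<Lambda> \<and> g ` \<Lambda> = \<Lambda> \<and>
     (\<exists>Es Eu :: torus3 \<Rightarrow> (real^3) set. \<exists>C \<mu> :: real.
        (\<forall>x\<in>\<Lambda>. subspace (Es x) \<and> subspace (Eu x) \<and> Es x \<inter> Eu x = {0} \<and>
                {u + v |u v. u \<in> Es x \<and> v \<in> Eu x} = UNIV) \<and>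
        (\<forall>x\<in>\<Lambda>. torus_deriv g x ` Es x = Es (g x) \<and> torus_deriv g x ` Eu x = Eu (g x)) \<and>
        C > 0 \<and> 0 < \<mu> \<and> \<mu> < 1 \<and>
        (\<forall>x\<in>\<Lambda>. \<forall>n\<ge>1.
           restr_norm_le (torus_deriv (g ^^ n) x) (Es x) (C * \<mu> ^ n) \<and>
           restr_norm_le (inv_into (Eu x) (torus_deriv (g ^^ n) x))
             (torus_deriv (g ^^ n) x ` Eu x) (C * \<mu> ^ n)))"

definition hyperbolic_basic_set :: "(torus3 \<Rightarrow> torus3) \<Rightarrow> torus3 set \<Rightarrow> bool" where
  "hyperbolic_basic_set g \<Lambda> \<longleftrightarrow> hyperbolic_set g \<Lambda> \<and>
     (\<exists>x\<in>\<Lambda>. \<Lambda> \<subseteq> closure (range (\<lambda>n. int_iter g n x)))"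

definition anosov :: "(torus3 \<Rightarrow> torus3) \<Rightarrow> bool" where
  "anosov g \<longleftrightarrow> g \<in> Diff 1 \<and> hyperbolic_set g UNIV"

definition no_unit_modulus_eigenvalue :: "int^3^3 \<Rightarrow> bool" where
  "no_unit_modulus_eigenvalue A \<longleftrightarrow>
     (\<forall>c::complex. (\<exists>v::complex^3. v \<noteq> 0 \<and> (\<chi> i j. of_int (A $ i $ j)) *v v = c *s v) \<longrightarrow> cmod c \<noteq> 1)"

definition linear_anosov :: "(torus3 \<Rightarrow> torus3) \<Rightarrow> bool" where
  "linear_anosov f \<longleftrightarrow>
     (\<exists>A :: int^3^3. \<bar>det A\<bar> = 1 \<and> no_unit_modulus_eigenvalue A \<and>
        (\<forall>x. f (proj_torus x) = proj_torus ((\<chi> i j. of_int (A $ i $ j)) *v x)))"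

subsection \<open>The residual sets of diffeomorphisms with trivial centralizer\<close>

text \<open>The data are those of the genericity theorem for \<open>\<Lambda>\<^sub>g\<close> the whole torus: an open neighborhood
  \<open>\<U>\<close> of \<open>f0\<close> on which the maximal invariant set of the ambient open set \<open>UNIV\<close>, which is again
  \<open>UNIV\<close>, is a hyperbolic basic set, and a residual subset \<open>R\<close> of \<open>\<U>\<close>. Centralizers of the
  restrictions to \<open>\<Lambda>\<^sub>g\<close> are then centralizers on the torus.\<close>

definition trivial_centralizer_residual_set ::
    "enat \<Rightarrow> (torus3 \<Rightarrow> torus3) \<Rightarrow> (torus3 \<Rightarrow> torus3) set \<Rightarrow> (torus3 \<Rightarrow> torus3) set \<Rightarrow> bool" where
  "trivial_centralizer_residual_set r f0 \<U> R \<longleftrightarrow>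
     1 \<le> r \<and> f0 \<in> \<U> \<and> openin (Diff_topology r) \<U> \<and>
     (\<forall>g\<in>\<U>. hyperbolic_basic_set g (\<Inter>n. int_iter g n ` UNIV)) \<and>
     residual_in (subtopology (Diff_topology r) \<U>) R \<and>
     (\<forall>g\<in>R. trivial_centralizer 1 g)"

end

theory Submission
  imports Defs
begin

text \<open>The automorphism \<open>f\<close> is induced by a companion matrix \<open>A\<close> of \<open>x\<^sup>3 - 3 x + 1\<close>. This polynomial
  has three real roots, none of modulus \<open>1\<close>, and \<open>x \<mapsto> x\<^sup>2 - 2\<close> permutes them cyclically. The
  matrix \<open>B = A\<^sup>2 - 2\<close> commutes with \<open>A\<close>, has the same eigenvectors, and its eigenvalues are those of
  \<open>A\<close> moved one step along the cycle. It is therefore invertible over the integers and hyperbolic, and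
  it induces the Anosov diffeomorphism \<open>h\<close> (\<open>hyperbolic_set_torus\<close>).

  A torus map has at most one linear lift, so \<open>h\<^sup>n = f\<^sup>m\<close> would force \<open>\<mu>\<^sub>i\<^sup>n = \<alpha>\<^sub>i\<^sup>m\<close> for all three pairs of
  eigenvalues. On one eigenvector both matrices expand, on another \<open>A\<close> expands and \<open>B\<close> contracts. The
  first makes \<open>m\<close> and \<open>n\<close> have equal signs, the second opposite signs, which is impossible for
  \<open>n \<noteq> 0\<close> (\<open>powi_sign_conflict\<close>). So the centralizer is nontrivial, for every degree of
  smoothness, and \<open>f\<close> lies in no set of maps with trivial \<open>C\<^sup>1\<close>-centralizer.

  Discreteness uses only that \<open>f\<close> is expansive (\<open>expansive\<close>), and no classification of the
  centralizer. If \<open>g\<close> and \<open>h0\<close> commute with \<open>f\<close> and are uniformly closer than the expansivity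
  constant, then \<open>f\<^sup>n (g p) = g (f\<^sup>n p)\<close> and \<open>f\<^sup>n (h0 p) = h0 (f\<^sup>n p)\<close> stay close for all integers
  \<open>n\<close>, hence \<open>g p = h0 p\<close> (\<open>discrete_centralizer\<close>).\<close>

section \<open>Torus maps induced by linear maps\<close>

definition linear_lift :: "(torus3 \<Rightarrow> torus3) \<Rightarrow> (real^3 \<Rightarrow> real^3) \<Rightarrow> bool" where
  "linear_lift g L \<longleftrightarrow> linear L \<and> (\<forall>x. g (proj_torus x) = proj_torus (L x))"

lemma linear_lift_comp:
  "linear_lift g L \<Longrightarrow> linear_lift g' L' \<Longrightarrow> linear_lift (g \<circ> g') (L \<circ> L')"
  by (simp add: linear_lift_def linear_compose)

lemma linear_lift_funpow: "linear_lift g L \<Longrightarrow> linear_lift (g ^^ n) (L ^^ n)"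
proof (induction n)
  case 0
  show ?case using bounded_linear.linear[OF bounded_linear_ident] by (simp add: linear_lift_def id_def)
next
  case (Suc n)
  then show ?case by (metis linear_lift_comp funpow.simps(2))
qed

text \<open>Rescaling the argument would give a nonzero integer coordinate the value \<open>1/2\<close>.\<close>

lemma linear_Ints_imp_zero:
  assumes "linear (D :: real^3 \<Rightarrow> real^3)" "\<And>x i. D x $ i \<in> \<int>"
  shows "D x = 0"
proof (rule ccontr)
  assume "D x \<noteq> 0"
  then obtain i where i: "D x $ i \<noteq> 0" by (auto simp: vec_eq_iff)
  have "D ((1 / (2 * D x $ i)) *\<^sub>R x) $ i = 1/2"
    using i by (simp add: linear_scale[OF assms(1)])
  then have "(1/2 :: real) \<in> \<int>" using assms(2) by metis
  then obtain k :: int where "(1/2::real) = of_int k" by (auto elim: Ints_cases)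
  then have "(1::real) = of_int (2 * k)" by simp
  then have "1 = 2 * k" by linarith
  then show False by presburger
qed

text \<open>Two lifts of the same map differ by a map into the lattice. This reduces equations between torus
  automorphisms to equations between their lifts, and so between eigenvalues.\<close>

lemma linear_lift_unique:
  assumes "linear_lift g L" "linear_lift g M"
  shows "L = M"
proof
  fix x
  have "linear (\<lambda>x. L x - M x)"
    using assms by (simp add: linear_lift_def linear_compose_sub)
  moreover have "(L x - M x) $ i \<in> \<int>" for x i
    using assms proj_torus_eq_iff[of "L x" "M x"] by (simp add: linear_lift_def)
  ultimately have "L x - M x = 0" by (rule linear_Ints_imp_zero)
  then show "L x = M x" by simp
qed

lemma linear_lift_inverse:
  assumes "linear_lift g L" "linear_lift g' L'" "\<And>x. L (L' x) = x"
  shows "bij g" "inv g = g'" "L' (L x) = x"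
proof -
  have "L \<circ> L' = id" using assms(3) by auto
  then have "L' \<circ> L = id"
    using linear_inverse_left assms(1,2) unfolding linear_lift_def by blast
  then have *: "L' (L x) = x" for x by (simp add: fun_eq_iff)
  then show "L' (L x) = x" .
  have "g \<circ> g' = id" "g' \<circ> g = id"
    using assms * surj_proj_torus by (auto simp: fun_eq_iff linear_lift_def) (metis surjD)+
  then show "bij g" "inv g = g'"
    by (auto intro: o_bij simp: inv_unique_comp)
qed

lemma higher_differentiable_on_const: "higher_differentiable_on n S (\<lambda>x. c)"
  by (induction n arbitrary: c) (auto simp: frechet_derivative_const)

lemma higher_differentiable_on_linear:
  assumes "linear (L :: real^3 \<Rightarrow> real^3)"
  shows "higher_differentiable_on n S L"
proof (cases n)
  case 0
  then show ?thesis by (simp add: assms linear_continuous_on linear_linear)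
next
  case (Suc m)
  have d: "(L has_derivative L) (at x)" for x
    by (rule linear_imp_has_derivative[OF assms])
  then have "frechet_derivative L (at x) = L" for x
    using frechet_derivative_at by metis
  with d Suc show ?thesis
    by (auto simp: differentiable_def higher_differentiable_on_const)
qed

lemma linear_lift_torus_map_of_class:
  assumes "linear_lift g L" shows "torus_map_of_class k g"
  unfolding torus_map_of_class_def
proof
  fix x :: "real^3"
  have "x \<in> UNIV \<and> local_lift UNIV L g \<and> smooth_of_class k UNIV L"
    using assms by (simp add: local_lift_def linear_lift_def smooth_of_class_def
      higher_differentiable_on_linear)
  then show "\<exists>S F. x \<in> S \<and> local_lift S F g \<and> smooth_of_class k S F" by blast
qed

lemma linear_lift_Diff:
  assumes "linear_lift g L" "linear_lift g' L'" "\<And>x. L (L' x) = x"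
  shows "g \<in> Diff k"
  using linear_lift_torus_map_of_class linear_lift_inverse[OF assms] assms(1,2)
  by (simp add: Diff_def)

lemma small_Ints_vec_eq_0:
  assumes "\<And>i. (w :: real^3) $ i \<in> \<int>" "norm w < 1"
  shows "w = 0"
proof -
  have "w $ i = 0" for i
    using assms(1)[of i] component_le_norm_cart[of w i] assms(2)
    by (auto elim!: Ints_cases)
  then show ?thesis by (simp add: vec_eq_iff)
qed

text \<open>Any other local lift differs from \<open>L\<close> by a lattice-valued function, which is constant near
  every point of continuity; so the local lift has the same derivative.\<close>

lemma torus_deriv_linear_lift:
  assumes g: "linear_lift g L"
  shows "torus_deriv g p = L"
  unfolding torus_deriv_def
proof (rule the_equality)
  have L: "linear L" and lift: "\<And>x. g (proj_torus x) = proj_torus (L x)"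
    using g by (auto simp: linear_lift_def)
  have dL: "(L has_derivative L) (at x)" for x by (rule linear_imp_has_derivative[OF L])
  obtain x where "p = proj_torus x" using surj_proj_torus by (metis surjD)
  then show "has_torus_derivative g L p"
    unfolding has_torus_derivative_def local_lift_def using lift dL
    by (intro exI[of _ UNIV] exI[of _ L] exI[of _ x]) auto
  fix M assume "has_torus_derivative g M p"
  then obtain S F x where S: "open S" "x \<in> S" and F: "\<And>y. y \<in> S \<Longrightarrow> g (proj_torus y) = proj_torus (F y)"
    and dF: "(F has_derivative M) (at x)"
    unfolding has_torus_derivative_def local_lift_def by blast
  define G where "G y = F y - L y" for y
  have int: "G y $ i \<in> \<int>" if "y \<in> S" for y i
    using F[OF that] lift[of y] proj_torus_eq_iff[of "F y" "L y"] by (simp add: G_def)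
  have dG: "(G has_derivative (\<lambda>h. M h - L h)) (at x)"
    unfolding G_def by (intro has_derivative_diff dF dL)
  then have "isCont G x" by (rule has_derivative_continuous)
  then have "\<forall>\<^sub>F y in at x. dist (G y) (G x) < 1"
    by (simp add: isCont_def tendsto_iff)
  moreover have "\<forall>\<^sub>F y in at x. y \<in> S" using S by (simp add: eventually_at_in_open')
  ultimately have "\<forall>\<^sub>F y in at x. G y = G x"
  proof eventually_elim
    case (elim y)
    then have "G y - G x = 0"
      by (intro small_Ints_vec_eq_0) (use int S in \<open>auto simp: dist_norm\<close>)
    then show ?case by simp
  qed
  then have "((\<lambda>y. G x) has_derivative (\<lambda>h. M h - L h)) (at x)"
    by (intro has_derivative_transform_eventually[OF dG]) auto
  then have "(\<lambda>h. M h - L h) = (\<lambda>h. 0)"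
    using has_derivative_unique has_derivative_const by blast
  then show "M = L" by (auto simp: fun_eq_iff)
qed

lemma compact_torus3: "compact (UNIV :: torus3 set)"
proof -
  have "continuous_on UNIV proj_torus"
    by (simp add: continuous_on_open_vimage open_torus3_def)
  then have "compact (proj_torus ` cbox 0 1)"
    by (meson compact_cbox compact_continuous_image continuous_on_subset subset_UNIV)
  moreover have "p \<in> proj_torus ` cbox 0 1" for p
  proof -
    obtain x where x: "p = proj_torus x" using surj_proj_torus by (metis surjD)
    let ?y = "\<chi> i. frac (x $ i)"
    have "proj_torus x = proj_torus ?y"
      by (simp add: proj_torus_eq_iff frac_def)
    moreover have "?y \<in> cbox 0 1"
      by (simp add: mem_box_cart frac_ge_0 less_imp_le frac_lt_1)
    ultimately show ?thesis using x by blast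
  qed
  ultimately show ?thesis by (metis UNIV_eq_I)
qed

section \<open>Uniform closeness on the torus\<close>

definition torus_near :: "real \<Rightarrow> torus3 \<Rightarrow> torus3 \<Rightarrow> bool" where
  "torus_near \<epsilon> p q \<longleftrightarrow> (\<exists>a b. p = proj_torus a \<and> q = proj_torus b \<and> norm (b - a) \<le> \<epsilon>)"

lemma torus_near_refl: "torus_near 0 p p"
proof -
  obtain x where "p = proj_torus x" using surj_proj_torus by (metis surjD)
  then show ?thesis unfolding torus_near_def by (intro exI[of _ x]) auto
qed

lemma torus_near_mono: "torus_near \<delta> p q \<Longrightarrow> \<delta> \<le> \<epsilon> \<Longrightarrow> torus_near \<epsilon> p q"
  unfolding torus_near_def using order_trans by blast

lemma torus_near_trans:
  assumes "torus_near \<delta> p q" "torus_near \<epsilon> q r"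
  shows "torus_near (\<delta> + \<epsilon>) p r"
proof -
  obtain a b c d where p: "p = proj_torus a" "q = proj_torus b" "norm (b - a) \<le> \<delta>"
    and q: "q = proj_torus c" "r = proj_torus d" "norm (d - c) \<le> \<epsilon>"
    using assms unfolding torus_near_def by blast
  have bc: "b $ i - c $ i \<in> \<int>" for i
    using p(2) q(1) proj_torus_eq_iff[of b c] by simp
  have "d $ i - (d + (b - c)) $ i \<in> \<int>" for i using Ints_minus[OF bc[of i]] by simp
  then have "r = proj_torus (d + (b - c))" using q(2) by (simp add: proj_torus_eq_iff)
  moreover have "norm (d + (b - c) - a) \<le> \<delta> + \<epsilon>"
    using norm_triangle_ineq[of "b - a" "d - c"] p(3) q(3) by (simp add: algebra_simps)
  ultimately show ?thesis using p(1) unfolding torus_near_def by blast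
qed

section \<open>Hyperbolic linear maps with an eigenbasis\<close>

text \<open>The functionals \<open>\<phi> i\<close> are the coordinates in the eigenbasis \<open>v\<close>. Everything below is read off from
  \<open>\<phi> i \<circ> L = \<mu> i * \<phi> i\<close>. The single rate \<open>\<rho>\<close> bounds both the contracting eigenvalues and the
  inverses of the expanding ones, so that the assumptions are invariant under passing to the inverse map.\<close>

locale hyperbolic_eigenbasis =
  fixes L :: "real^3 \<Rightarrow> real^3" and v :: "3 \<Rightarrow> real^3"
    and \<phi> :: "3 \<Rightarrow> real^3 \<Rightarrow> real" and \<mu> :: "3 \<Rightarrow> real" and \<rho> :: real
  assumes linear_L: "linear L" and linear_\<phi>: "linear (\<phi> i)"
    and dual: "\<phi> i (v j) = (if i = j then 1 else 0)"
    and eigenvector: "L (v i) = \<mu> i *\<^sub>R v i"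
    and rho: "0 < \<rho>" "\<rho> < 1"
    and nonzero: "\<mu> i \<noteq> 0"
    and rate: "\<bar>\<mu> i\<bar> \<le> \<rho> \<or> 1 / \<bar>\<mu> i\<bar> \<le> \<rho>"
begin

text \<open>The coordinate map is a left inverse of the synthesis map on a space of the same dimension, so it
  is also a right inverse.\<close>

lemma expansion: "(\<Sum>i\<in>UNIV. \<phi> i x *\<^sub>R v i) = x"
proof -
  define V :: "real^3 \<Rightarrow> real^3" where "V c = (\<Sum>i\<in>UNIV. c $ i *\<^sub>R v i)" for c
  define \<Phi> :: "real^3 \<Rightarrow> real^3" where "\<Phi> y = (\<chi> i. \<phi> i y)" for y
  have V: "linear V" unfolding V_def
    by (rule linearI) (simp_all add: scaleR_left_distrib sum.distrib scaleR_sum_right)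
  have P: "linear \<Phi>" unfolding \<Phi>_def
    by (rule linearI) (simp_all add: vec_eq_iff linear_add[OF linear_\<phi>] linear_scale[OF linear_\<phi>])
  have "\<Phi> \<circ> V = id"
    by (auto simp: fun_eq_iff \<Phi>_def V_def vec_eq_iff linear_sum[OF linear_\<phi>]
      linear_scale[OF linear_\<phi>] dual if_distrib cong: if_cong)
  then have "V \<circ> \<Phi> = id" using linear_inverse_left[OF P V] by blast
  then show ?thesis by (simp add: fun_eq_iff V_def \<Phi>_def)
qed

lemma eq_0I: "(\<And>i. \<phi> i x = 0) \<Longrightarrow> x = 0"
  using expansion[of x] by simp

lemma \<phi>_sum: "\<phi> i (\<Sum>j\<in>UNIV. c j *\<^sub>R v j) = c i"
  by (simp add: linear_sum[OF linear_\<phi>] linear_scale[OF linear_\<phi>] dual if_distrib cong: if_cong)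

lemma \<phi>_L: "\<phi> i (L x) = \<mu> i * \<phi> i x"
proof -
  have "L x = L (\<Sum>j\<in>UNIV. \<phi> j x *\<^sub>R v j)" by (simp add: expansion)
  also have "\<dots> = (\<Sum>j\<in>UNIV. (\<mu> j * \<phi> j x) *\<^sub>R v j)"
    by (simp add: linear_sum[OF linear_L] linear_scale[OF linear_L] eigenvector mult.commute)
  finally show ?thesis by (simp add: \<phi>_sum)
qed

lemma \<phi>_funpow: "\<phi> i ((L ^^ n) x) = \<mu> i ^ n * \<phi> i x"
  by (induction n) (simp_all add: \<phi>_L)

lemma funpow_eigenvector: "(L ^^ n) (v i) = \<mu> i ^ n *\<^sub>R v i"
  by (induction n) (simp_all add: linear_scale[OF linear_L] eigenvector mult.commute)

text \<open>Statements about backward orbits of \<open>L\<close> become statements about forward orbits of \<open>L'\<close>.\<close>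

lemma inverse_eigenbasis:
  assumes "linear L'" "\<And>x. L' (L x) = x"
  shows "hyperbolic_eigenbasis L' v \<phi> (\<lambda>i. inverse (\<mu> i)) \<rho>"
proof (rule hyperbolic_eigenbasis.intro)
  have "L' (\<mu> i *\<^sub>R v i) = v i" for i using assms(2)[of "v i"] by (simp add: eigenvector)
  then have "\<mu> i *\<^sub>R L' (v i) = v i" for i by (simp add: linear_scale[OF assms(1)])
  then show "L' (v i) = inverse (\<mu> i) *\<^sub>R v i" for i
    by (metis left_inverse nonzero scaleR_one scaleR_scaleR)
  show "\<bar>inverse (\<mu> i)\<bar> \<le> \<rho> \<or> 1 / \<bar>inverse (\<mu> i)\<bar> \<le> \<rho>" for i
    using rate[of i] by (auto simp: abs_inverse divide_inverse)
qed (use assms(1) linear_\<phi> dual rho nonzero in simp_all)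

definition stable :: "(real^3) set" where
  "stable = {x. \<forall>i. \<rho> < \<bar>\<mu> i\<bar> \<longrightarrow> \<phi> i x = 0}"

definition unstable :: "(real^3) set" where
  "unstable = {x. \<forall>i. \<bar>\<mu> i\<bar> \<le> \<rho> \<longrightarrow> \<phi> i x = 0}"

text \<open>The summand \<open>1\<close> makes the hyperbolicity constant obviously positive.\<close>

definition norm_const :: real where
  "norm_const = 1 + (\<Sum>i\<in>UNIV. onorm (\<phi> i) * norm (v i))"

lemma norm_const_pos: "norm_const > 0"
  unfolding norm_const_def
  by (intro add_pos_nonneg sum_nonneg mult_nonneg_nonneg onorm_pos_le)
     (auto simp: linear_\<phi> linear_linear)

lemma subspace_stable: "subspace stable" and subspace_unstable: "subspace unstable"
  by (auto simp: subspace_def stable_def unstable_def linear_0[OF linear_\<phi>]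
      linear_add[OF linear_\<phi>] linear_scale[OF linear_\<phi>])

lemma stable_inter_unstable: "stable \<inter> unstable = {0}"
proof -
  have "x = 0" if "x \<in> stable" "x \<in> unstable" for x
    using that by (intro eq_0I) (auto simp: stable_def unstable_def not_le[symmetric])
  then show ?thesis using subspace_0[OF subspace_stable] subspace_0[OF subspace_unstable] by auto
qed

lemma stable_plus_unstable: "{a + b |a b. a \<in> stable \<and> b \<in> unstable} = UNIV"
proof -
  have "\<exists>a b. x = a + b \<and> a \<in> stable \<and> b \<in> unstable" for x
  proof (intro exI conjI)
    let ?a = "\<Sum>i\<in>UNIV. (if \<bar>\<mu> i\<bar> \<le> \<rho> then \<phi> i x else 0) *\<^sub>R v i"
    let ?b = "\<Sum>i\<in>UNIV. (if \<bar>\<mu> i\<bar> \<le> \<rho> then 0 else \<phi> i x) *\<^sub>R v i"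
    have "?a + ?b = (\<Sum>i\<in>UNIV. \<phi> i x *\<^sub>R v i)"
      by (auto simp: sum.distrib[symmetric] intro!: sum.cong)
    then show "x = ?a + ?b" by (simp add: expansion)
    show "?a \<in> stable" unfolding stable_def by (auto simp: \<phi>_sum)
    show "?b \<in> unstable" unfolding unstable_def by (auto simp: \<phi>_sum)
  qed
  then show ?thesis by auto
qed

lemma image_stable: "L ` stable = stable" and image_unstable: "L ` unstable = unstable"
proof -
  let ?M = "\<lambda>x. \<Sum>i\<in>UNIV. (\<phi> i x / \<mu> i) *\<^sub>R v i"
  have "L (?M x) - x = 0" for x
    by (rule eq_0I) (simp add: linear_diff[OF linear_\<phi>] \<phi>_L \<phi>_sum nonzero)
  then have M: "x = L (?M x)" for x by simp
  have "?M x \<in> stable" if "x \<in> stable" for x using that by (auto simp: stable_def \<phi>_sum)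
  moreover have "?M x \<in> unstable" if "x \<in> unstable" for x using that by (auto simp: unstable_def \<phi>_sum)
  ultimately show "L ` stable = stable" "L ` unstable = unstable"
    using M by (auto intro: image_eqI) (auto simp: stable_def unstable_def \<phi>_L)
qed

lemma norm_le_of_coordinates:
  assumes "\<And>i. \<bar>\<phi> i x\<bar> \<le> c * \<bar>\<phi> i y\<bar>" "0 \<le> c"
  shows "norm x \<le> norm_const * c * norm y"
proof -
  have "norm x = norm (\<Sum>i\<in>UNIV. \<phi> i x *\<^sub>R v i)" by (simp add: expansion)
  also have "\<dots> \<le> (\<Sum>i\<in>UNIV. norm (\<phi> i x *\<^sub>R v i))" by (rule norm_sum)
  also have "\<dots> \<le> (\<Sum>i\<in>UNIV. c * norm y * (onorm (\<phi> i) * norm (v i)))"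
  proof (rule sum_mono)
    fix i
    have "\<bar>\<phi> i y\<bar> \<le> onorm (\<phi> i) * norm y"
      using onorm[of "\<phi> i" y] linear_\<phi> by (simp add: linear_linear)
    then have "\<bar>\<phi> i x\<bar> \<le> c * (onorm (\<phi> i) * norm y)"
      using assms mult_left_mono order_trans by blast
    then have "\<bar>\<phi> i x\<bar> * norm (v i) \<le> c * (onorm (\<phi> i) * norm y) * norm (v i)"
      by (rule mult_right_mono) simp
    then show "norm (\<phi> i x *\<^sub>R v i) \<le> c * norm y * (onorm (\<phi> i) * norm (v i))"
      by (simp add: mult_ac)
  qed
  also have "\<dots> = c * norm y * (norm_const - 1)"
    by (simp add: norm_const_def sum_distrib_left)
  also have "\<dots> \<le> c * norm y * norm_const"
    using assms(2) by (intro mult_left_mono) auto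
  finally show ?thesis by (simp add: mult_ac)
qed

lemma norm_funpow_stable:
  assumes "x \<in> stable" shows "norm ((L ^^ n) x) \<le> norm_const * \<rho> ^ n * norm x"
proof (rule norm_le_of_coordinates)
  show "\<bar>\<phi> i ((L ^^ n) x)\<bar> \<le> \<rho> ^ n * \<bar>\<phi> i x\<bar>" for i
    using assms by (cases "\<bar>\<mu> i\<bar> \<le> \<rho>")
      (auto simp: \<phi>_funpow abs_mult power_abs stable_def intro!: mult_right_mono power_mono)
qed (use rho in auto)

lemma norm_unstable:
  assumes "x \<in> unstable" shows "norm x \<le> norm_const * \<rho> ^ n * norm ((L ^^ n) x)"
proof (rule norm_le_of_coordinates)
  fix i
  show "\<bar>\<phi> i x\<bar> \<le> \<rho> ^ n * \<bar>\<phi> i ((L ^^ n) x)\<bar>"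
  proof (cases "\<bar>\<mu> i\<bar> \<le> \<rho>")
    case False
    then have "1 \<le> \<rho> * \<bar>\<mu> i\<bar>" using rate[of i] nonzero[of i] by (auto simp: field_simps)
    then have "1 \<le> (\<rho> * \<bar>\<mu> i\<bar>) ^ n" by (rule one_le_power)
    then have "1 * \<bar>\<phi> i x\<bar> \<le> (\<rho> * \<bar>\<mu> i\<bar>) ^ n * \<bar>\<phi> i x\<bar>" by (rule mult_right_mono) simp
    then show ?thesis by (simp add: \<phi>_funpow abs_mult power_abs power_mult_distrib mult_ac)
  qed (use assms in \<open>auto simp: unstable_def \<phi>_funpow\<close>)
qed (use rho in auto)

lemma inj_funpow: "inj (L ^^ n)"
proof (rule injI)
  fix x y assume "(L ^^ n) x = (L ^^ n) y"
  then have "\<mu> i ^ n * \<phi> i x = \<mu> i ^ n * \<phi> i y" for i by (metis \<phi>_funpow)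
  then have "x - y = 0" by (intro eq_0I) (simp add: linear_diff[OF linear_\<phi>] nonzero)
  then show "x = y" by simp
qed

lemma hyperbolic_set_torus:
  assumes g: "linear_lift g L" and "surj g"
  shows "hyperbolic_set g UNIV"
proof -
  have d: "torus_deriv (g ^^ n) p = L ^^ n" for n p
    by (intro torus_deriv_linear_lift linear_lift_funpow g)
  have d1: "torus_deriv g p = L" for p
    by (intro torus_deriv_linear_lift g)
  have s: "restr_norm_le (L ^^ n) stable (norm_const * \<rho> ^ n)" for n
    by (simp add: restr_norm_le_def norm_funpow_stable)
  have u: "restr_norm_le (inv_into unstable (L ^^ n)) ((L ^^ n) ` unstable) (norm_const * \<rho> ^ n)" for n
    using inj_funpow[of n] inv_into_f_f[of "L ^^ n" unstable]
    by (auto simp: restr_norm_le_def norm_unstable inj_on_subset)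
  show ?thesis
    unfolding hyperbolic_set_def d d1
    by (rule conjI[OF compact_torus3], rule conjI[OF assms(2)], rule exI[of _ "\<lambda>_. stable"],
        rule exI[of _ "\<lambda>_. unstable"], rule exI[of _ norm_const], rule exI[of _ \<rho>])
      (intro conjI ballI allI impI; rule subspace_stable subspace_unstable stable_inter_unstable
        stable_plus_unstable image_stable image_unstable norm_const_pos rho s u)
qed

text \<open>A nonzero coordinate in an expanding direction grows geometrically along the orbit.\<close>

lemma bounded_orbit_imp_stable:
  assumes "\<And>n. norm ((L ^^ n) x) \<le> B"
  shows "x \<in> stable"
  unfolding stable_def
proof (intro CollectI allI impI)
  fix i assume "\<rho> < \<bar>\<mu> i\<bar>"
  then have "1 / \<bar>\<mu> i\<bar> < 1" using rate[of i] rho by linarith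
  then have \<mu>: "1 < \<bar>\<mu> i\<bar>" using nonzero[of i] by (simp add: divide_less_eq)
  show "\<phi> i x = 0"
  proof (rule ccontr)
    assume nz: "\<phi> i x \<noteq> 0"
    have "\<bar>\<mu> i\<bar> ^ n * \<bar>\<phi> i x\<bar> \<le> onorm (\<phi> i) * B" for n
    proof -
      have "\<bar>\<mu> i\<bar> ^ n * \<bar>\<phi> i x\<bar> = \<bar>\<phi> i ((L ^^ n) x)\<bar>"
        by (simp add: \<phi>_funpow abs_mult power_abs)
      also have "\<dots> \<le> onorm (\<phi> i) * norm ((L ^^ n) x)"
        using onorm[of "\<phi> i" "(L ^^ n) x"] linear_\<phi> by (simp add: linear_linear)
      also have "\<dots> \<le> onorm (\<phi> i) * B"
        using assms linear_\<phi> by (intro mult_left_mono onorm_pos_le) (auto simp: linear_linear)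
      finally show ?thesis .
    qed
    then have "\<bar>\<mu> i\<bar> ^ n \<le> onorm (\<phi> i) * B / \<bar>\<phi> i x\<bar>" for n
      using nz by (simp add: field_simps)
    then show False using real_arch_pow[OF \<mu>] by (meson not_le)
  qed
qed

lemma int_iter_linear_lift:
  assumes g: "linear_lift g L" and g': "linear_lift (inv g) L'" and L': "\<And>x. L' (L x) = x"
  shows "\<exists>M. linear_lift (int_iter g m) M \<and> (\<forall>i. M (v i) = (\<mu> i powi m) *\<^sub>R v i)"
proof -
  interpret I: hyperbolic_eigenbasis L' v \<phi> "\<lambda>i. inverse (\<mu> i)" \<rho>
    using g' L' by (intro inverse_eigenbasis) (auto simp: linear_lift_def)
  show ?thesis
  proof (cases "m \<ge> 0")
    case True
    then show ?thesis using linear_lift_funpow[OF g] funpow_eigenvector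
      by (auto simp: int_iter_def power_int_def intro!: exI[of _ "L ^^ nat m"])
  next
    case False
    then show ?thesis using linear_lift_funpow[OF g'] I.funpow_eigenvector
      by (auto simp: int_iter_def power_int_def intro!: exI[of _ "L' ^^ nat (- m)"])
  qed
qed

text \<open>If the orbits of \<open>a\<close> and \<open>b\<close> stay close on the torus, then the lifted orbits stay close in
  \<open>\<real>\<^sup>3\<close>: the next lifted difference and the next small difference agree up to a lattice vector, whose
  norm is at most \<open>(K + 1) \<epsilon> < 1\<close>. The difference \<open>b - a\<close> then has a bounded orbit under \<open>L\<close>.\<close>

lemma forward_close_imp_stable:
  assumes g: "linear_lift g L" and K: "\<And>x. norm (L x) \<le> K * norm x" "0 \<le> K" "(K + 1) * \<epsilon> < 1"
    and ab: "norm (b - a) \<le> \<epsilon>"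
    and near: "\<And>n. torus_near \<epsilon> ((g ^^ n) (proj_torus a)) ((g ^^ n) (proj_torus b))"
  shows "b - a \<in> stable"
proof (rule bounded_orbit_imp_stable)
  have lift: "(g ^^ n) (proj_torus x) = proj_torus ((L ^^ n) x)" for n x
    using linear_lift_funpow[OF g] by (simp add: linear_lift_def)
  have diff: "(L ^^ n) (b - a) = (L ^^ n) b - (L ^^ n) a" for n
    using linear_lift_funpow[OF g] by (simp add: linear_lift_def linear_diff)
  show "norm ((L ^^ n) (b - a)) \<le> \<epsilon>" for n
  proof (induction n)
    case 0
    then show ?case using ab by simp
  next
    case (Suc n)
    let ?w = "(L ^^ Suc n) (b - a)"
    obtain c d where c: "proj_torus ((L ^^ Suc n) a) = proj_torus c"
      and d: "proj_torus ((L ^^ Suc n) b) = proj_torus d" and cd: "norm (d - c) \<le> \<epsilon>"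
      using near[of "Suc n"] unfolding torus_near_def lift by blast
    have "norm ?w \<le> K * \<epsilon>"
      using K(1)[of "(L ^^ n) (b - a)"] mult_left_mono[OF Suc K(2)] by simp
    then have "norm (?w - (d - c)) < 1"
      using cd K(3) norm_triangle_ineq4[of ?w "d - c"] by (simp add: algebra_simps)
    moreover have "(?w - (d - c)) $ i \<in> \<int>" for i
    proof -
      have "((L ^^ Suc n) b $ i - d $ i) - ((L ^^ Suc n) a $ i - c $ i) \<in> \<int>"
        using c d unfolding proj_torus_eq_iff by (blast intro: Ints_diff)
      then show ?thesis unfolding diff by (simp add: algebra_simps)
    qed
    ultimately have "?w - (d - c) = 0" by (intro small_Ints_vec_eq_0) auto
    then show ?case using cd by simp
  qed
qed

text \<open>The same small difference \<open>b - a\<close> is stable for \<open>L\<close> by the forward orbit and stable for \<open>L'\<close>, that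
  is, unstable for \<open>L\<close>, by the backward orbit.\<close>

lemma expansive:
  assumes g: "linear_lift g L" and g': "linear_lift g' L'" and LL': "\<And>x. L (L' x) = x"
  obtains \<epsilon> where "\<epsilon> > 0" "\<And>p q. \<lbrakk>\<And>n. torus_near \<epsilon> ((g ^^ n) p) ((g ^^ n) q);
    \<And>n. torus_near \<epsilon> ((g' ^^ n) p) ((g' ^^ n) q)\<rbrakk> \<Longrightarrow> p = q"
proof -
  have L': "linear L'" using g' by (simp add: linear_lift_def)
  interpret I: hyperbolic_eigenbasis L' v \<phi> "\<lambda>i. inverse (\<mu> i)" \<rho>
    using L' linear_lift_inverse(3)[OF assms] by (rule inverse_eigenbasis)
  define K where "K = max (onorm L) (onorm L')"
  have K: "norm (L x) \<le> K * norm x" "norm (L' x) \<le> K * norm x" for x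
  proof -
    have "norm (L x) \<le> onorm L * norm x" "norm (L' x) \<le> onorm L' * norm x"
      using onorm linear_L L' linear_linear by blast+
    then show "norm (L x) \<le> K * norm x" "norm (L' x) \<le> K * norm x"
      unfolding K_def by (meson max.cobounded1 max.cobounded2 mult_right_mono norm_ge_zero order_trans)+
  qed
  have K0: "0 \<le> K" unfolding K_def using onorm_pos_le[of L] linear_L
    by (simp add: linear_linear le_max_iff_disj)
  define \<epsilon> where "\<epsilon> = 1 / (2 * (K + 1))"
  have \<epsilon>: "\<epsilon> > 0" "(K + 1) * \<epsilon> < 1" using K0 by (auto simp: \<epsilon>_def)
  show ?thesis
  proof (rule that[OF \<epsilon>(1)])
    fix p q
    assume fwd: "\<And>n. torus_near \<epsilon> ((g ^^ n) p) ((g ^^ n) q)"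
      and bwd: "\<And>n. torus_near \<epsilon> ((g' ^^ n) p) ((g' ^^ n) q)"
    obtain a b where ab: "p = proj_torus a" "q = proj_torus b" "norm (b - a) \<le> \<epsilon>"
      using fwd[of 0] by (auto simp: torus_near_def)
    have "b - a \<in> stable"
      using fwd unfolding ab by (intro forward_close_imp_stable[OF g K(1) K0 \<epsilon>(2) ab(3)])
    moreover have "b - a \<in> I.stable"
      using bwd unfolding ab by (intro I.forward_close_imp_stable[OF g' K(2) K0 \<epsilon>(2) ab(3)])
    moreover have "\<rho> < \<bar>inverse (\<mu> i)\<bar>" if "\<bar>\<mu> i\<bar> \<le> \<rho>" for i
    proof -
      have "\<bar>\<mu> i\<bar> < 1" using that rho by simp
      then have "1 < inverse \<bar>\<mu> i\<bar>" using nonzero[of i] by (intro one_less_inverse) auto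
      then show ?thesis using rho by (simp add: abs_inverse)
    qed
    ultimately have "b - a = 0"
      by (intro eq_0I) (auto simp: stable_def I.stable_def not_le[symmetric])
    then show "p = q" using ab by simp
  qed
qed

end

section \<open>Discreteness of the centralizer of an expansive map\<close>

text \<open>Asking for a bound \<open>\<delta>\<close> strictly below \<open>\<epsilon>\<close> that serves all points leaves room for a further uniform
  perturbation, which makes the set open.\<close>

lemma openin_uniform_ball:
  "openin (Diff_topology r) {h \<in> Diff r. \<exists>\<delta><\<epsilon>. \<forall>p. torus_near \<delta> (h0 p) (h p)}" (is "openin _ ?V")
  unfolding openin_Diff_topology Diff_open_def
proof (intro conjI ballI)
  show "?V \<subseteq> Diff r" by auto
  fix h assume "h \<in> ?V"
  then obtain \<delta> where \<delta>: "\<delta> < \<epsilon>" "\<And>p. torus_near \<delta> (h0 p) (h p)" by auto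
  define \<eta> where "\<eta> = (\<epsilon> - \<delta>) / 2"
  have "Cr_nhd r 0 \<eta> h \<subseteq> ?V"
  proof
    fix k assume k: "k \<in> Cr_nhd r 0 \<eta> h"
    have "torus_near (\<delta> + \<eta>) (h0 p) (k p)" for p
    proof -
      obtain x where x: "p = proj_torus x" using surj_proj_torus by (metis surjD)
      obtain S F G where S: "x \<in> S" "local_lift S F h" "local_lift S G k"
        and vs: "\<forall>vs. set vs \<subseteq> Basis \<and> length vs \<le> 0 \<longrightarrow>
          norm (iter_deriv vs F x - iter_deriv vs G x) < \<eta>"
        using k unfolding Cr_nhd_def by blast
      have "norm (F x - G x) < \<eta>" using vs[rule_format, of "[]"] by simp
      then have "torus_near \<eta> (h p) (k p)"
        unfolding torus_near_def using S x
        by (intro exI[of _ "F x"] exI[of _ "G x"]) (auto simp: local_lift_def norm_minus_commute)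
      then show ?thesis by (rule torus_near_trans[OF \<delta>(2)])
    qed
    moreover have "\<delta> + \<eta> < \<epsilon>" using \<delta>(1) by (simp add: \<eta>_def field_simps)
    ultimately show "k \<in> ?V" using k by (auto simp: Cr_nhd_def)
  qed
  then show "\<exists>n \<eta>. enat n \<le> r \<and> \<eta> > 0 \<and> Cr_nhd r n \<eta> h \<subseteq> ?V"
    using \<delta>(1) by (intro exI[of _ 0] exI[of _ \<eta>]) (auto simp: \<eta>_def zero_enat_def[symmetric])
qed

text \<open>The open ball with the expansivity constant as radius isolates each element of the centralizer:
  commuting maps that are uniformly close send a point to two points with close \<open>f\<close>-orbits.\<close>

lemma discrete_centralizer:
  assumes "bij f" "\<epsilon> > 0"
    and expansive: "\<And>p q. \<lbrakk>\<And>n. torus_near \<epsilon> ((f ^^ n) p) ((f ^^ n) q);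
      \<And>n. torus_near \<epsilon> ((inv f ^^ n) p) ((inv f ^^ n) q)\<rbrakk> \<Longrightarrow> p = q"
  shows "subtopology (Diff_topology r) (centralizer r f) = discrete_topology (centralizer r f)"
proof -
  have comm: "h ((f ^^ n) p) = (f ^^ n) (h p)" "h ((inv f ^^ n) p) = (inv f ^^ n) (h p)"
    if "h \<in> centralizer r f" for h n p
  proof -
    have *: "h (f q) = f (h q)" for q using that by (auto simp: centralizer_def fun_eq_iff)
    then have **: "h (inv f q) = inv f (h q)" for q
      using \<open>bij f\<close> by (metis bij_inv_eq_iff)
    show "h ((f ^^ n) p) = (f ^^ n) (h p)" by (induction n) (simp_all add: *)
    show "h ((inv f ^^ n) p) = (inv f ^^ n) (h p)" by (induction n) (simp_all add: **)
  qed
  have "openin (subtopology (Diff_topology r) (centralizer r f)) {h0}"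
    if h0: "h0 \<in> centralizer r f" for h0
  proof -
    let ?V = "{h \<in> Diff r. \<exists>\<delta><\<epsilon>. \<forall>p. torus_near \<delta> (h0 p) (h p)}"
    have "h = h0" if h: "h \<in> centralizer r f" "h \<in> ?V" for h
    proof
      fix p
      obtain \<delta> where "\<delta> < \<epsilon>" "\<And>q. torus_near \<delta> (h0 q) (h q)" using h(2) by auto
      then have near: "torus_near \<epsilon> (h0 q) (h q)" for q
        by (meson torus_near_mono less_imp_le)
      have "h0 p = h p"
        using near[of "(f ^^ _) p"] near[of "(inv f ^^ _) p"]
        by (intro expansive) (simp_all add: comm[OF h0] comm[OF h(1)])
      then show "h p = h0 p" by simp
    qed
    moreover have "h0 \<in> ?V"
      using h0 \<open>\<epsilon> > 0\<close> by (auto simp: centralizer_def torus_near_refl intro!: exI[of _ 0])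
    ultimately have "{h0} = ?V \<inter> centralizer r f" using h0 by blast
    then show ?thesis unfolding openin_subtopology
      by (intro exI[of _ ?V] conjI openin_uniform_ball)
  qed
  moreover have "topspace (subtopology (Diff_topology r) (centralizer r f)) = centralizer r f"
    by (auto simp: topspace_Diff_topology centralizer_def)
  ultimately show ?thesis by (metis discrete_topology_unique)
qed

section \<open>The two commuting automorphisms\<close>

definition real_matrix :: "int^3^3 \<Rightarrow> real^3^3" where
  "real_matrix A = (\<chi> i j. of_int (A $ i $ j))"

definition torus_matrix :: "int^3^3 \<Rightarrow> torus3 \<Rightarrow> torus3" where
  "torus_matrix A p = proj_torus (real_matrix A *v rep_torus p)"

lemma torus_matrix_lift: "linear_lift (torus_matrix A) ((*v) (real_matrix A))"
  unfolding linear_lift_def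
proof (intro conjI allI)
  show "linear ((*v) (real_matrix A))" by simp
  fix x
  let ?y = "rep_torus (proj_torus x)"
  have "proj_torus ?y = proj_torus x" by (rule Quotient3_abs_rep[OF Quotient3_torus3])
  then have y: "?y $ i - x $ i \<in> \<int>" for i by (simp add: proj_torus_eq_iff)
  have "(real_matrix A *v ?y) $ i - (real_matrix A *v x) $ i
      = (\<Sum>j\<in>UNIV. of_int (A $ i $ j) * (?y $ j - x $ j))" for i
    by (simp add: matrix_vector_mult_def real_matrix_def sum_subtractf[symmetric] algebra_simps)
  also have "\<dots> i \<in> \<int>" for i using y by (intro Ints_sum Ints_mult) auto
  finally show "torus_matrix A (proj_torus x) = proj_torus (real_matrix A *v x)"
    by (simp add: torus_matrix_def proj_torus_eq_iff)
qed

text \<open>A companion matrix of \<open>x\<^sup>3 - 3 x + 1\<close>; the polynomial gives \<open>A\<^sup>-\<^sup>1 = 3 - A\<^sup>2\<close>.\<close>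

definition A_mat :: "int^3^3" where
  "A_mat = vector [vector [0, 1, 0], vector [0, 0, 1], vector [- 1, 3, 0]]"

definition A_inv :: "int^3^3" where
  "A_inv = vector [vector [3, 0, - 1], vector [1, 0, 0], vector [0, 1, 0]]"

text \<open>This is \<open>A\<^sup>2 - 2\<close>. Its eigenvalues are again the three roots, so its inverse is
  \<open>3 - B\<^sup>2 = 1 + A + B\<close>.\<close>

definition B_mat :: "int^3^3" where
  "B_mat = vector [vector [- 2, 0, 1], vector [- 1, 1, 0], vector [0, - 1, 1]]"

definition B_inv :: "int^3^3" where
  "B_inv = vector [vector [- 1, 1, 1], vector [- 1, 2, 1], vector [- 1, 2, 2]]"

lemma A_apply: "real_matrix A_mat *v x = vector [x $ 2, x $ 3, 3 * x $ 2 - x $ 1]"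
  and A_inv_apply: "real_matrix A_inv *v x = vector [3 * x $ 1 - x $ 3, x $ 1, x $ 2]"
  and B_apply: "real_matrix B_mat *v x = vector [x $ 3 - 2 * x $ 1, x $ 2 - x $ 1, x $ 3 - x $ 2]"
  and B_inv_apply: "real_matrix B_inv *v x =
    vector [x $ 2 + x $ 3 - x $ 1, 2 * x $ 2 + x $ 3 - x $ 1, 2 * x $ 2 + 2 * x $ 3 - x $ 1]"
  by (simp_all add: vec_eq_iff forall_3 matrix_vector_mult_def sum_3 real_matrix_def
      A_mat_def A_inv_def B_mat_def B_inv_def)

lemma A_A_inv: "real_matrix A_mat *v (real_matrix A_inv *v x) = x"
  and B_B_inv: "real_matrix B_mat *v (real_matrix B_inv *v x) = x"
  by (simp_all add: A_apply A_inv_apply B_apply B_inv_apply vec_eq_iff forall_3)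

lemma A_B_commute:
  "real_matrix A_mat *v (real_matrix B_mat *v x) = real_matrix B_mat *v (real_matrix A_mat *v x)"
  by (simp add: A_apply B_apply vec_eq_iff forall_3)

text \<open>One root \<open>x\<close> comes from the intermediate value theorem on \<open>[3/2, 8/5]\<close>. The others are its images
  under \<open>x \<mapsto> x\<^sup>2 - 2\<close>, which maps roots to roots and has order \<open>3\<close> on them. The bounds keep the
  moduli away from \<open>1\<close>, with \<open>\<alpha> 2\<close> the only contracting root.\<close>

lemma cubic_roots:
  "\<exists>\<alpha> :: 3 \<Rightarrow> real. (\<forall>i. \<alpha> i ^ 3 = 3 * \<alpha> i - 1) \<and>
    3/2 \<le> \<alpha> 1 \<and> \<alpha> 1 \<le> 8/5 \<and> 1/4 \<le> \<alpha> 2 \<and> \<alpha> 2 \<le> 14/25 \<and> \<alpha> 3 \<le> - 8/5 \<and>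
    (\<alpha> 1)\<^sup>2 - 2 = \<alpha> 2 \<and> (\<alpha> 2)\<^sup>2 - 2 = \<alpha> 3 \<and> (\<alpha> 3)\<^sup>2 - 2 = \<alpha> 1"
proof -
  have "\<exists>x\<ge>3/2. x \<le> 8/5 \<and> x ^ 3 - 3 * x + 1 = (0::real)"
    by (rule IVT') (auto simp: power3_eq_cube intro!: continuous_intros)
  then obtain x :: real where x: "3/2 \<le> x" "x \<le> 8/5" "x ^ 3 - 3 * x + 1 = 0" by blast
  have x3: "x ^ 3 = 3 * x - 1" using x(3) by simp
  have step: "(y\<^sup>2 - 2) ^ 3 = 3 * (y\<^sup>2 - 2) - 1" if "y ^ 3 = 3 * y - 1" for y :: real
    using that by algebra
  define y where "y = x\<^sup>2 - 2"
  define z where "z = y\<^sup>2 - 2"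
  have "(3/2)\<^sup>2 \<le> x\<^sup>2" "x\<^sup>2 \<le> (8/5)\<^sup>2" using x by (auto intro!: power_mono)
  then have y: "1/4 \<le> y" "y \<le> 14/25" by (simp_all add: y_def power2_eq_square)
  have "y\<^sup>2 \<le> (14/25)\<^sup>2" using y by (intro power_mono) auto
  then have z: "z \<le> - 8/5" by (simp_all add: z_def power2_eq_square)
  have zx: "z\<^sup>2 - 2 = x" using x3 unfolding z_def y_def by algebra
  define \<alpha> :: "3 \<Rightarrow> real" where "\<alpha> i = (if i = 1 then x else if i = 2 then y else z)" for i
  have "\<alpha> 1 = x" "\<alpha> 2 = y" "\<alpha> 3 = z" by (simp_all add: \<alpha>_def)
  moreover have "\<alpha> i ^ 3 = 3 * \<alpha> i - 1" for i
    using x3 step[OF x3] step[OF step[OF x3]] by (simp add: \<alpha>_def y_def z_def)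
  ultimately show ?thesis using x y z zx y_def z_def by (intro exI[of _ \<alpha>]) simp
qed

text \<open>An eigenvalue satisfies \<open>c\<^sup>3 + 1 = 3 c\<close>; on the unit circle the left side has modulus at most
  \<open>2\<close> and the right side modulus \<open>3\<close>.\<close>

lemma no_unit_modulus_eigenvalue_A: "no_unit_modulus_eigenvalue A_mat"
  unfolding no_unit_modulus_eigenvalue_def
proof (intro allI impI notI)
  fix c :: complex
  assume "\<exists>v::complex^3. v \<noteq> 0 \<and> (\<chi> i j. of_int (A_mat $ i $ j)) *v v = c *s v"
  then obtain v :: "complex^3" where v: "v \<noteq> 0"
    and ev: "(\<chi> i j. of_int (A_mat $ i $ j)) *v v = c *s v" by blast
  assume c: "cmod c = 1"
  have row: "(\<Sum>j\<in>UNIV. of_int (A_mat $ i $ j) * v $ j) = c * v $ i" for i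
    using ev by (simp add: vec_eq_iff matrix_vector_mult_def)
  have e: "v $ 2 = c * v $ 1" "v $ 3 = c * v $ 2" "3 * v $ 2 - v $ 1 = c * v $ 3"
    subgoal using row[of 1] by (simp add: sum_3 A_mat_def)
    subgoal using row[of 2] by (simp add: sum_3 A_mat_def)
    subgoal using row[of 3] by (simp add: sum_3 A_mat_def)
    done
  then have "v $ 1 \<noteq> 0" using v by (auto simp: vec_eq_iff forall_3)
  moreover have "(c ^ 3 - 3 * c + 1) * v $ 1 = 0" using e by algebra
  ultimately have "c ^ 3 - 3 * c + 1 = 0" by simp
  then have "c ^ 3 + 1 = 3 * c" by algebra
  then have "cmod (3 * c) \<le> cmod (c ^ 3) + cmod 1" by (metis norm_triangle_ineq)
  then show False using c by (simp add: norm_mult norm_power)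
qed

lemma det_A: "det A_mat = - 1 \<or> det A_mat = 1"
  by (simp add: det_3 A_mat_def)

lemma linear_anosov_A: "linear_anosov (torus_matrix A_mat)"
  using no_unit_modulus_eigenvalue_A det_A torus_matrix_lift[of A_mat]
  unfolding linear_anosov_def linear_lift_def real_matrix_def by (intro exI[of _ A_mat]) auto

definition vandermonde_vec :: "real \<Rightarrow> real^3" where
  "vandermonde_vec \<alpha> = vector [1, \<alpha>, \<alpha>\<^sup>2]"

text \<open>The coefficient of \<open>vandermonde_vec \<alpha>\<close> in the eigenbasis. Since the roots have sum \<open>0\<close> and product
  \<open>-1\<close>, the other two have sum \<open>-\<alpha>\<close> and product \<open>\<alpha>\<^sup>2 - 3\<close>, so Lagrange interpolation on the
  three roots is expressed through \<open>\<alpha>\<close> alone. The denominator is the derivative of the cubic at \<open>\<alpha>\<close>.\<close>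

definition lagrange_functional :: "real \<Rightarrow> real^3 \<Rightarrow> real" where
  "lagrange_functional \<alpha> x = (x $ 3 + \<alpha> * x $ 2 + (\<alpha>\<^sup>2 - 3) * x $ 1) / (3 * \<alpha>\<^sup>2 - 3)"

lemma linear_lagrange_functional: "linear (lagrange_functional \<alpha>)"
  by (rule linearI) (simp_all add: lagrange_functional_def add_divide_distrib[symmetric] algebra_simps)

lemma lagrange_dual:
  assumes "\<kappa> ^ 3 = 3 * \<kappa> - 1" "\<alpha> ^ 3 = 3 * \<alpha> - 1" "\<alpha>\<^sup>2 \<noteq> 1"
  shows "lagrange_functional \<alpha> (vandermonde_vec \<kappa>) = (if \<alpha> = \<kappa> then 1 else 0)"
proof (cases "\<alpha> = \<kappa>")
  case True
  then show ?thesis using assms(3)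
    by (simp add: lagrange_functional_def vandermonde_vec_def power2_eq_square field_simps)
next
  case False
  have "(\<kappa> - \<alpha>) * (\<kappa>\<^sup>2 + \<alpha> * \<kappa> + (\<alpha>\<^sup>2 - 3)) = 0" using assms(1,2) by algebra
  then show ?thesis using False
    by (simp add: lagrange_functional_def vandermonde_vec_def)
qed

lemma A_eigenvector:
  assumes "\<alpha> ^ 3 = 3 * \<alpha> - 1"
  shows "real_matrix A_mat *v vandermonde_vec \<alpha> = \<alpha> *\<^sub>R vandermonde_vec \<alpha>"
  using assms
  by (simp add: A_apply vandermonde_vec_def vec_eq_iff forall_3 power2_eq_square power3_eq_cube)

lemma B_eigenvector:
  assumes "\<alpha> ^ 3 = 3 * \<alpha> - 1"
  shows "real_matrix B_mat *v vandermonde_vec \<alpha> = (\<alpha>\<^sup>2 - 2) *\<^sub>R vandermonde_vec \<alpha>"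
  using assms
  by (simp add: B_apply vandermonde_vec_def vec_eq_iff forall_3) algebra

text \<open>After taking logarithms, the first equation gives \<open>m\<close> and \<open>n\<close> equal signs, the second opposite signs.\<close>

lemma powi_sign_conflict:
  fixes a b c d :: real
  assumes "\<bar>a\<bar> > 1" "\<bar>b\<bar> > 1" "\<bar>c\<bar> > 1" "\<bar>d\<bar> < 1" "d \<noteq> 0"
    and "a powi m = b powi n" "c powi m = d powi n" "n \<noteq> 0"
  shows False
proof -
  have ln: "ln \<bar>x powi k\<bar> = of_int k * ln \<bar>x\<bar>" if "x \<noteq> 0" for x :: real and k
    using that by (simp add: power_int_def power_abs ln_realpow abs_inverse ln_inverse)
  have eq: "of_int m * ln \<bar>a\<bar> = of_int n * ln \<bar>b\<bar>" "of_int m * ln \<bar>c\<bar> = of_int n * ln \<bar>d\<bar>"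
    using assms ln by (metis abs_zero not_one_less_zero)+
  have pos: "ln \<bar>a\<bar> > 0" "ln \<bar>b\<bar> > 0" "ln \<bar>c\<bar> > 0" "ln \<bar>d\<bar> < 0" using assms by auto
  consider "n > 0" | "n < 0" using assms by linarith
  then show False
  proof cases
    case 1
    then have "of_int m * ln \<bar>a\<bar> > 0" "of_int m * ln \<bar>c\<bar> < 0"
      unfolding eq using pos by (simp_all add: mult_pos_neg)
    then show False using pos by (simp add: zero_less_mult_iff mult_less_0_iff)
  next
    case 2
    then have "of_int m * ln \<bar>a\<bar> < 0" "of_int m * ln \<bar>c\<bar> > 0"
      unfolding eq using pos by (simp_all add: mult_neg_pos mult_neg_neg)
    then show False using pos by (simp add: zero_less_mult_iff mult_less_0_iff)
  qed
qed

theorem mainTheorem4: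
  shows "\<exists>f. linear_anosov f \<and>
    subtopology (Diff_topology \<infinity>) (centralizer \<infinity> f) = discrete_topology (centralizer \<infinity> f) \<and>
    \<not> trivial_centralizer \<infinity> f \<and>
    (\<exists>h \<in> centralizer \<infinity> f. anosov h \<and>
       (\<forall>m n :: int. m \<noteq> 0 \<longrightarrow> n \<noteq> 0 \<longrightarrow> int_iter h n \<noteq> int_iter f m)) \<and>
    (\<forall>r f0 \<U> R. trivial_centralizer_residual_set r f0 \<U> R \<longrightarrow> f \<notin> R)"
proof -
  obtain \<alpha> :: "3 \<Rightarrow> real" where root: "\<forall>i. \<alpha> i ^ 3 = 3 * \<alpha> i - 1"
    and bounds: "3/2 \<le> \<alpha> 1" "\<alpha> 1 \<le> 8/5" "1/4 \<le> \<alpha> 2" "\<alpha> 2 \<le> 14/25" "\<alpha> 3 \<le> - 8/5"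
    and cycle: "(\<alpha> 1)\<^sup>2 - 2 = \<alpha> 2" "(\<alpha> 2)\<^sup>2 - 2 = \<alpha> 3" "(\<alpha> 3)\<^sup>2 - 2 = \<alpha> 1"
    using cubic_roots by blast
  note root = root[rule_format]
  define \<mu> where "\<mu> i = (\<alpha> i)\<^sup>2 - 2" for i
  have \<mu>: "\<mu> 1 = \<alpha> 2" "\<mu> 2 = \<alpha> 3" "\<mu> 3 = \<alpha> 1" using cycle by (simp_all add: \<mu>_def)
  let ?v = "\<lambda>i. vandermonde_vec (\<alpha> i)" and ?\<phi> = "\<lambda>i. lagrange_functional (\<alpha> i)"
  define A B A' B' where "A = (*v) (real_matrix A_mat)" and "B = (*v) (real_matrix B_mat)"
    and "A' = (*v) (real_matrix A_inv)" and "B' = (*v) (real_matrix B_inv)"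
  define f h f' h' where "f = torus_matrix A_mat" and "h = torus_matrix B_mat"
    and "f' = torus_matrix A_inv" and "h' = torus_matrix B_inv"
  have lifts: "linear_lift f A" "linear_lift h B" "linear_lift f' A'" "linear_lift h' B'"
    by (simp_all add: f_def h_def f'_def h'_def A_def B_def A'_def B'_def torus_matrix_lift)
  have inverses: "\<And>x. A (A' x) = x" "\<And>x. B (B' x) = x"
    by (simp_all add: A_def B_def A'_def B'_def A_A_inv B_B_inv)
  note f_inv = linear_lift_inverse[OF lifts(1,3) inverses(1)]
  note h_inv = linear_lift_inverse[OF lifts(2,4) inverses(2)]
  have "\<alpha> i = \<alpha> j \<Longrightarrow> i = j" for i j
    using exhaust_3[of i] exhaust_3[of j] bounds by auto
  moreover have "(\<alpha> i)\<^sup>2 \<noteq> 1" for i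
    using exhaust_3[of i] bounds by (auto simp: power2_eq_1_iff)
  ultimately have dual: "?\<phi> i (?v j) = (if i = j then 1 else 0)" for i j
    using lagrange_dual[OF root root] by metis
  \<comment> \<open>The moduli of the roots are at most \<open>14/25\<close> or at least \<open>3/2\<close>; hence the rate \<open>3/4\<close>.\<close>
  have rate: "\<bar>\<alpha> i\<bar> \<le> 3/4 \<or> 1 / \<bar>\<alpha> i\<bar> \<le> 3/4" "\<alpha> i \<noteq> 0" for i
    using exhaust_3[of i] bounds by (auto simp: field_simps)
  have rate': "\<bar>\<mu> i\<bar> \<le> 3/4 \<or> 1 / \<bar>\<mu> i\<bar> \<le> 3/4" "\<mu> i \<noteq> 0" for i
    using exhaust_3[of i] rate \<mu> by metis+
  interpret A: hyperbolic_eigenbasis A ?v ?\<phi> \<alpha> "3/4"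
    by (rule hyperbolic_eigenbasis.intro)
      (use lifts dual rate root in \<open>simp_all add: linear_lift_def linear_lagrange_functional A_def A_eigenvector\<close>)
  interpret B: hyperbolic_eigenbasis B ?v ?\<phi> \<mu> "3/4"
    by (rule hyperbolic_eigenbasis.intro)
      (use lifts dual rate' root in \<open>simp_all add: linear_lift_def linear_lagrange_functional B_def B_eigenvector \<mu>_def\<close>)
  have Diff_h: "h \<in> Diff k" for k by (rule linear_lift_Diff[OF lifts(2,4) inverses(2)])
  have "h (f p) = f (h p)" for p
  proof -
    obtain x where "p = proj_torus x" using surj_proj_torus by (metis surjD)
    then show ?thesis using lifts A_B_commute[of x] by (simp add: linear_lift_def A_def B_def)
  qed
  then have h: "h \<in> centralizer k f" for k using Diff_h by (auto simp: centralizer_def)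
  have distinct: "int_iter h n \<noteq> int_iter f m" if n: "n \<noteq> 0" for n m
  proof
    assume eq: "int_iter h n = int_iter f m"
    obtain M N where M: "linear_lift (int_iter f m) M" "\<And>i. M (?v i) = (\<alpha> i powi m) *\<^sub>R ?v i"
      and N: "linear_lift (int_iter h n) N" "\<And>i. N (?v i) = (\<mu> i powi n) *\<^sub>R ?v i"
      using A.int_iter_linear_lift[of f A' m] B.int_iter_linear_lift[of h B' n] lifts f_inv h_inv by metis
    have "M = N" using M(1) N(1) eq linear_lift_unique by metis
    moreover have "?v i \<noteq> 0" for i by (simp add: vandermonde_vec_def vec_eq_iff forall_3)
    ultimately have "\<alpha> i powi m = \<mu> i powi n" for i using M(2)[of i] N(2)[of i] by simp
    \<comment> \<open>Both maps expand the third eigenvector; the first one is expanded by \<open>f\<close> and contracted by \<open>h\<close>.\<close>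
    from this[of 3] this[of 1] show False
      using powi_sign_conflict[of "\<alpha> 3" "\<alpha> 1" "\<alpha> 1" "\<alpha> 2" m n] n \<mu> bounds by auto
  qed
  have "h \<notin> range (int_iter f)"
  proof
    assume "h \<in> range (int_iter f)"
    then obtain m where "h = int_iter f m" by blast
    moreover have "int_iter h 1 = h" by (simp add: int_iter_def)
    ultimately show False using distinct[of 1 m] by simp
  qed
  then have nontrivial: "\<not> trivial_centralizer k f" for k
    using h by (auto simp: trivial_centralizer_def)
  have "linear_anosov f" unfolding f_def by (rule linear_anosov_A)
  moreover have "subtopology (Diff_topology \<infinity>) (centralizer \<infinity> f) = discrete_topology (centralizer \<infinity> f)"
  proof (rule A.expansive[OF lifts(1,3) inverses(1)])
    fix \<epsilon> :: real
    assume "\<epsilon> > 0" "\<And>p q. \<lbrakk>\<And>n. torus_near \<epsilon> ((f ^^ n) p) ((f ^^ n) q);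
      \<And>n. torus_near \<epsilon> ((f' ^^ n) p) ((f' ^^ n) q)\<rbrakk> \<Longrightarrow> p = q"
    then show ?thesis using f_inv(1,2) by (intro discrete_centralizer[of f \<epsilon>]) auto
  qed
  moreover have "anosov h"
    using Diff_h B.hyperbolic_set_torus[OF lifts(2)] h_inv(1) by (simp add: anosov_def bij_is_surj)
  ultimately show ?thesis using h distinct nontrivial
    by (intro exI[of _ f]) (auto simp: trivial_centralizer_residual_set_def)
qed

end
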